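(* Suppose that $f\in\mathcal{B}$ and $f(z)=\sum_{n=0}^{\infty}a_{pn+m}z^{pn+m}$, where $p\in\mathbb{N}$ and $0\le m\le p$. Then the following sharp inequality holds: $$\sum_{n=0}^{\infty}|a_{pn+m}|r^{pn+m}+\left(\frac{1}{1+|a_m|}+\frac{r^p}{1-r^p}\right)\sum_{n=1}^{\infty}|a_{pn+m}|^2r^{2pn+m}\le 1\quad\text{for } r\le r_{p,m,a_m},$$ where $r_{p,m,a_m}$ is the unique positive root of the equation $$(1-|a_m|-|a_m|^2)r^{p+m}+r^p+|a_m|r^m-1=0.$$ Further, we have $r_{p,m,a_m}\ge\sqrt[p]{1/(2+|a_m|)}$.
   Context: $\mathbb{D}=\{z\in\mathbb{C}:|z|<1\}$ is the unit disk and $\mathcal{B}$ is the set of all analytic self-maps of $\mathbb{D}$. Here $m$ is an integer and $r\in[0,1)$ plays the role of $|z|$ for $z\in\mathbb{D}$. "Sharp" refers to the radius: for $a\in[0,1)$, the radius $r_{p,m,a}$ (the one corresponding to $|a_m|=a$) cannot be replaced by a larger number so that the inequality still holds for all $f\in\mathcal{B}$ of the stated form with $|a_m|=a$.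
   Formalization: The root r_{p,m,a_m} is taken as the unique root in (0,1], not among all positive reals: uniqueness there fails, e.g. for p=m=1, |a_m|=0.9 the equation has positive roots near 0.72 and 1.96. *)

theory Defs
  imports "HOL-Complex_Analysis.Complex_Analysis"
begin

definition disk_self_maps :: "(complex \<Rightarrow> complex) set" where
  "disk_self_maps = {f. f analytic_on ball 0 1 \<and> f ` ball 0 1 \<subseteq> ball 0 1}"

(* Only the values a (p * n + m) matter; the other values of a are never used. *)
definition lacunary_expansion ::
    "nat \<Rightarrow> nat \<Rightarrow> (nat \<Rightarrow> complex) \<Rightarrow> (complex \<Rightarrow> complex) \<Rightarrow> bool" where
  "lacunary_expansion p m a f \<longleftrightarrow>
     (\<forall>z\<in>ball 0 1. (\<lambda>n. a (p * n + m) * z ^ (p * n + m)) sums f z)"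

definition majorant_term :: "nat \<Rightarrow> nat \<Rightarrow> (nat \<Rightarrow> complex) \<Rightarrow> real \<Rightarrow> nat \<Rightarrow> real" where
  "majorant_term p m a r n = cmod (a (p * n + m)) * r ^ (p * n + m)"

definition square_term :: "nat \<Rightarrow> nat \<Rightarrow> (nat \<Rightarrow> complex) \<Rightarrow> real \<Rightarrow> nat \<Rightarrow> real" where
  "square_term p m a r n = (cmod (a (p * n + m)))\<^sup>2 * r ^ (2 * p * n + m)"

(* The second series starts at n = 1, hence the Suc. *)
definition bohr_sum :: "nat \<Rightarrow> nat \<Rightarrow> (nat \<Rightarrow> complex) \<Rightarrow> real \<Rightarrow> real" where
  "bohr_sum p m a r =
     (\<Sum>n. majorant_term p m a r n)
     + (1 / (1 + cmod (a m)) + r ^ p / (1 - r ^ p)) * (\<Sum>n. square_term p m a r (Suc n))"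

(* Roots are taken in (0,1]: if m > 0 and 1 - \<alpha> - \<alpha>^2 < 0 with \<alpha> < 1, the
   equation has a further root beyond 1.  The endpoint 1 is the root for \<alpha> = 1, m > 0. *)
definition is_radius_root :: "nat \<Rightarrow> nat \<Rightarrow> real \<Rightarrow> real \<Rightarrow> bool" where
  "is_radius_root p m \<alpha> r \<longleftrightarrow>
     0 < r \<and> r \<le> 1 \<and>
     (1 - \<alpha> - \<alpha>\<^sup>2) * r ^ (p + m) + r ^ p + \<alpha> * r ^ m - 1 = 0"

definition bohr_radius :: "nat \<Rightarrow> nat \<Rightarrow> real \<Rightarrow> real" where
  "bohr_radius p m \<alpha> = (THE r. is_radius_root p m \<alpha> r)"

end

theory Submission
  imports Defs
begin

text \<open>Write f(z) = z^m g(z^p) with g(w) = b_0 + b_1 w + ..., so that b_n = a_(pn+m), and put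
  \<alpha> = |b_0|, \<rho> = r^p.  For every polynomial h the coefficient of w^n in g h^2 is at most the
  mean of |h|^2 on the unit circle.  Choosing the coefficients of h as conjugates of
  b_0, ..., b_k with k = n div 2 gives Carlson's refined bounds
  |b_(2k+1)| \<le> 1 - (|b_0|^2 + ... + |b_k|^2) and
  |b_(2k)| \<le> 1 - (|b_0|^2 + ... + |b_(k-1)|^2) - |b_k|^2 / (1 + \<alpha>).
  Multiplied by \<rho>^n and added up, they bound the Bohr sum by
  r^m (\<alpha> + (1 - \<alpha>^2) \<rho> / (1 - \<rho>)), a strictly increasing function of r if \<alpha> < 1,
  which equals 1 exactly at the root in question.
  For g(w) = (w - \<alpha>) / (1 - \<alpha> w) equality holds, whence sharpness.\<close>

section \<open>Averages over roots of unity\<close>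

lemma ex_primitive_root_unity:
  fixes N :: nat
  assumes "N \<ge> 1"
  obtains \<zeta> :: complex where "cmod \<zeta> = 1" "\<And>j. \<zeta> ^ j = 1 \<longleftrightarrow> N dvd j"
proof
  let ?z = "exp (2 * of_real pi * \<i> / of_nat N)"
  show "cmod ?z = 1"
    by (simp add: norm_exp_eq_Re)
  fix j :: nat
  have "?z ^ j = exp (2 * of_real pi * \<i> * of_nat j / of_nat N)"
    by (simp add: exp_of_nat_mult [symmetric] algebra_simps)
  then show "?z ^ j = 1 \<longleftrightarrow> N dvd j"
    using complex_root_unity_eq_1[OF assms, of j] by simp
qed

text \<open>The sum is geometric with ratio \<open>\<zeta> ^ j\<close>, and the \<open>N\<close>-th
  power of this ratio is 1; so it vanishes unless the ratio itself is 1.\<close>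

lemma sum_primitive_root_powers:
  fixes \<zeta> :: complex
  assumes "\<And>j. \<zeta> ^ j = 1 \<longleftrightarrow> N dvd j"
  shows "(\<Sum>k<N. (\<zeta> ^ k) ^ j) = (if N dvd j then of_nat N else 0)"
proof -
  have eq: "(\<zeta> ^ k) ^ j = (\<zeta> ^ j) ^ k" for k
    by (simp add: power_mult [symmetric] mult.commute)
  show ?thesis
  proof (cases "N dvd j")
    case True
    then have "\<zeta> ^ j = 1" using assms by blast
    then show ?thesis using True by (simp add: eq)
  next
    case False
    then have ne: "\<zeta> ^ j \<noteq> 1" using assms by blast
    have "(\<zeta> ^ j) ^ N = 1"
      using assms[of "j * N"] by (simp add: power_mult)
    then have "(1 - \<zeta> ^ j) * (\<Sum>k<N. (\<zeta> ^ j) ^ k) = 0"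
      by (metis diff_self one_diff_power_eq)
    then show ?thesis using ne False by (simp add: eq)
  qed
qed

text \<open>Since \<open>d < N\<close>, two exponents up to \<open>d\<close> are congruent modulo
  \<open>N\<close> only if they are equal, so averaging over the \<open>N\<close>-th roots of unity
  kills all mixed products of the expanded square. This finite mean replaces the integral over the
  circle.\<close>

lemma discrete_parseval:
  fixes \<zeta> :: complex and h :: "nat \<Rightarrow> complex"
  assumes z: "cmod \<zeta> = 1" "\<And>j. \<zeta> ^ j = 1 \<longleftrightarrow> N dvd j" and "d < N"
  shows "(\<Sum>k<N. (cmod (\<Sum>j\<le>d. h j * (\<zeta> ^ k) ^ j))\<^sup>2) = of_nat N * (\<Sum>j\<le>d. (cmod (h j))\<^sup>2)"
proof -
  \<comment> \<open>On \<open>N\<close>-th roots of unity conjugation becomes a power with the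
    natural exponent \<open>N - j\<close>, which makes \<open>sum_primitive_root_powers\<close>
    applicable.\<close>
  have cnj_pow: "cnj (w ^ j) = w ^ (N - j)" if "w ^ N = 1" "cmod w = 1" "j \<le> d" for w :: complex and j
  proof -
    have "w ^ j * w ^ (N - j) = 1"
      using that assms(3) by (simp add: power_add [symmetric])
    moreover have "w ^ j * cnj (w ^ j) = 1"
      using that by (simp add: complex_norm_square [symmetric] norm_power del: complex_cnj_power)
    moreover have "w ^ j \<noteq> 0" using that by auto
    ultimately show ?thesis by (metis mult_left_cancel)
  qed
  have unit: "(\<zeta> ^ k) ^ N = 1" "cmod (\<zeta> ^ k) = 1" for k
    using z(1) z(2)[of "k * N"] by (simp_all add: power_mult [symmetric] norm_power)
  have dvd: "N dvd i + (N - j) \<longleftrightarrow> i = j" if "i \<le> d" "j \<le> d" for i j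
  proof
    assume "N dvd i + (N - j)"
    then obtain q where q: "i + (N - j) = N * q" by (auto elim: dvdE)
    have "i + (N - j) > 0" "i + (N - j) < N * 2" using that assms(3) by auto
    then have "q = 1" using q by (cases q; cases "q - 1") auto
    then show "i = j" using q that assms(3) by auto
  qed (use that assms(3) in auto)
  have "complex_of_real (\<Sum>k<N. (cmod (\<Sum>j\<le>d. h j * (\<zeta> ^ k) ^ j))\<^sup>2)
      = (\<Sum>k<N. (\<Sum>i\<le>d. h i * (\<zeta> ^ k) ^ i) * cnj (\<Sum>j\<le>d. h j * (\<zeta> ^ k) ^ j))"
    by (simp only: of_real_sum complex_norm_square)
  also have "\<dots> = (\<Sum>k<N. \<Sum>i\<le>d. \<Sum>j\<le>d. h i * cnj (h j) * (\<zeta> ^ k) ^ (i + (N - j)))"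
    unfolding cnj_sum sum_product complex_cnj_mult
    by (intro sum.cong refl) (simp add: cnj_pow[OF unit] power_add mult_ac del: complex_cnj_power)
  also have "\<dots> = (\<Sum>i\<le>d. \<Sum>j\<le>d. \<Sum>k<N. h i * cnj (h j) * (\<zeta> ^ k) ^ (i + (N - j)))"
    by (simp only: sum.swap[of _ "{..<N}"]) 
  also have "\<dots> = (\<Sum>i\<le>d. \<Sum>j\<le>d. h i * cnj (h j) * (if i = j then of_nat N else 0))"
    by (simp only: sum_distrib_left [symmetric] sum_primitive_root_powers[OF z(2)])
       (intro sum.cong refl, simp add: dvd)
  also have "\<dots> = (\<Sum>i\<le>d. h i * cnj (h i) * of_nat N)"
    by (intro sum.cong refl) (simp add: if_distrib cong: if_cong)
  also have "\<dots> = complex_of_real (of_nat N * (\<Sum>j\<le>d. (cmod (h j))\<^sup>2))"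
    by (simp add: complex_norm_square [symmetric] sum_distrib_left mult.commute del: of_real_power)
  finally show ?thesis by (simp only: of_real_eq_iff)
qed

text \<open>Averaging the series against \<open>w ^ (N - n)\<close>, the conjugate of
  \<open>w ^ n\<close> on the \<open>N\<close>-th roots of unity, yields \<open>c n\<close> plus the
  aliased coefficients whose index exceeds \<open>n\<close> by a multiple of \<open>N\<close>. For
  large \<open>N\<close> these lie in the tail of a convergent series, and
  \<open>discrete_parseval\<close> evaluates the mean of the bound.\<close>

lemma coeff_le_mean_square:
  fixes c h :: "nat \<Rightarrow> complex"
  assumes sm: "summable (\<lambda>i. cmod (c i))"
    and le: "\<And>w. cmod w = 1 \<Longrightarrow> cmod (\<Sum>i. c i * w ^ i) \<le> M * (cmod (\<Sum>j\<le>d. h j * w ^ j))\<^sup>2"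
  shows "cmod (c n) \<le> M * (\<Sum>j\<le>d. (cmod (h j))\<^sup>2)"
proof (rule field_le_epsilon)
  fix e :: real assume "e > 0"
  from suminf_exist_split[OF this sm] obtain N0
    where N0: "\<And>N. N \<ge> N0 \<Longrightarrow> norm (\<Sum>i. cmod (c (i + N))) < e" by blast
  define N where "N = Suc (max N0 (max n d))"
  have N: "N \<ge> 1" "N \<ge> N0" "n < N" "d < N" by (auto simp: N_def)
  have tail: "(\<Sum>i. cmod (c (i + N))) < e"
    using N0[OF N(2)] by simp
  obtain \<zeta> :: complex where z: "cmod \<zeta> = 1" "\<And>j. \<zeta> ^ j = 1 \<longleftrightarrow> N dvd j"
    using ex_primitive_root_unity[OF N(1)] by blast
  have unit: "cmod (\<zeta> ^ k) = 1" for k using z(1) by (simp add: norm_power)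
  \<comment> \<open>The sum of the powers with exponent \<open>i + (N - n)\<close> over the
    \<open>N\<close>-th roots of unity: for \<open>i < N\<close> it singles out
    \<open>i = n\<close>, and beyond that only its bound by \<open>N\<close> is used.\<close>
  define \<psi> :: "nat \<Rightarrow> complex" where "\<psi> i = (if N dvd i + (N - n) then of_nat N else 0)" for i
  define S where "S = (\<Sum>k<N. (\<Sum>i. c i * (\<zeta> ^ k) ^ i) * (\<zeta> ^ k) ^ (N - n))"
  have "(\<lambda>i. c i * w ^ i) sums (\<Sum>i. c i * w ^ i)" if "cmod w = 1" for w
    by (rule summable_sums, rule summable_norm_cancel) (use that sm in \<open>simp add: norm_mult norm_power\<close>)
  then have "(\<lambda>i. \<Sum>k<N. c i * (\<zeta> ^ k) ^ i * (\<zeta> ^ k) ^ (N - n)) sums S"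
    unfolding S_def by (intro sums_sum sums_mult2) (use unit in auto)
  moreover have "(\<Sum>k<N. c i * (\<zeta> ^ k) ^ i * (\<zeta> ^ k) ^ (N - n)) = c i * \<psi> i" for i
    unfolding \<psi>_def sum_primitive_root_powers[OF z(2), symmetric]
    by (simp add: sum_distrib_left power_add mult.assoc)
  ultimately have S: "(\<lambda>i. c i * \<psi> i) sums S" by simp
  have psi_lt: "\<psi> i = (if i = n then of_nat N else 0)" if "i < N" for i
  proof -
    have "N dvd i + (N - n) \<longleftrightarrow> i = n"
    proof
      assume "N dvd i + (N - n)"
      then obtain q where q: "i + (N - n) = N * q" by (auto elim: dvdE)
      have "i + (N - n) > 0" "i + (N - n) < N * 2" using that N by auto
      then have "q = 1" using q by (cases q; cases "q - 1") auto
      then show "i = n" using q that N by auto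
    qed (use that N in auto)
    then show ?thesis by (simp add: \<psi>_def)
  qed
  have psi_le: "cmod (\<psi> i) \<le> N" for i by (simp add: \<psi>_def)
  have "(\<Sum>i<N. c i * \<psi> i) = (\<Sum>i<N. if i = n then c n * N else 0)"
    by (intro sum.cong refl) (simp add: psi_lt)
  also have "\<dots> = c n * N"
    using N(3) by simp
  finally have "(\<Sum>i<N. c i * \<psi> i) = c n * N" .
  then have split: "S = (\<Sum>i. c (i + N) * \<psi> (i + N)) + c n * N"
    using suminf_split_initial_segment[OF sums_summable[OF S], of N] sums_unique[OF S] by simp
  have smN: "summable (\<lambda>i. cmod (c (i + N)))"
    using sm by (subst summable_iff_shift)
  have "cmod (\<Sum>i. c (i + N) * \<psi> (i + N)) \<le> (\<Sum>i. N * cmod (c (i + N)))"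
    by (rule norm_suminf_le)
       (use psi_le smN in \<open>auto simp: norm_mult mult.commute[of "cmod (c _)"] intro!: mult_right_mono summable_mult\<close>)
  also have "\<dots> = N * (\<Sum>i. cmod (c (i + N)))"
    using smN by (rule suminf_mult)
  finally have rest: "cmod (\<Sum>i. c (i + N) * \<psi> (i + N)) \<le> N * e"
    using tail N(1) by (meson less_eq_real_def mult_left_mono of_nat_0_le_iff order_trans)
  have "cmod S \<le> (\<Sum>k<N. cmod ((\<Sum>i. c i * (\<zeta> ^ k) ^ i) * (\<zeta> ^ k) ^ (N - n)))"
    unfolding S_def by (rule norm_sum)
  also have "\<dots> \<le> (\<Sum>k<N. M * (cmod (\<Sum>j\<le>d. h j * (\<zeta> ^ k) ^ j))\<^sup>2)"
    by (intro sum_mono) (use le unit in \<open>simp add: norm_mult norm_power z(1)\<close>)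
  also have "\<dots> = N * (M * (\<Sum>j\<le>d. (cmod (h j))\<^sup>2))"
    by (simp only: sum_distrib_left [symmetric] discrete_parseval[OF z N(4)]) simp
  finally have "N * cmod (c n) \<le> N * (M * (\<Sum>j\<le>d. (cmod (h j))\<^sup>2)) + N * e"
    using split rest norm_triangle_ineq4[of S "\<Sum>i. c (i + N) * \<psi> (i + N)"]
    by (simp add: norm_mult mult.commute)
  then have "N * cmod (c n) \<le> N * (M * (\<Sum>j\<le>d. (cmod (h j))\<^sup>2) + e)"
    by (simp add: algebra_simps)
  then show "cmod (c n) \<le> M * (\<Sum>j\<le>d. (cmod (h j))\<^sup>2) + e"
    using N(1) by simp
qed

section \<open>Products of power series on the unit circle\<close>

definition conv :: "(nat \<Rightarrow> complex) \<Rightarrow> (nat \<Rightarrow> complex) \<Rightarrow> nat \<Rightarrow> complex" where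
  "conv a b n = (\<Sum>i\<le>n. a i * b (n - i))"

lemma summable_norm_conv:
  assumes "summable (\<lambda>i. cmod (a i))" "summable (\<lambda>i. cmod (b i))"
  shows "summable (\<lambda>i. cmod (conv a b i))"
proof (rule summable_comparison_test')
  show "summable (\<lambda>n. \<Sum>i\<le>n. cmod (a i) * cmod (b (n - i)))"
    using summable_Cauchy_product[of "\<lambda>i. cmod (a i)" "\<lambda>i. cmod (b i)"] assms by simp
  show "norm (cmod (conv a b n)) \<le> (\<Sum>i\<le>n. cmod (a i) * cmod (b (n - i)))" if "n \<ge> 0" for n
    unfolding conv_def by (simp add: norm_mult [symmetric] norm_sum)
qed

lemma suminf_conv:
  assumes "summable (\<lambda>i. cmod (a i))" "summable (\<lambda>i. cmod (b i))" "cmod w = 1"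
  shows "(\<Sum>i. conv a b i * w ^ i) = (\<Sum>i. a i * w ^ i) * (\<Sum>i. b i * w ^ i)"
proof -
  have "(\<Sum>i. a i * w ^ i) * (\<Sum>i. b i * w ^ i)
      = (\<Sum>k. \<Sum>i\<le>k. a i * w ^ i * (b (k - i) * w ^ (k - i)))"
    by (rule Cauchy_product) (use assms in \<open>simp_all add: norm_mult norm_power\<close>)
  also have "(\<lambda>k. \<Sum>i\<le>k. a i * w ^ i * (b (k - i) * w ^ (k - i))) = (\<lambda>k. conv a b k * w ^ k)"
  proof
    fix k
    have "a i * w ^ i * (b (k - i) * w ^ (k - i)) = a i * b (k - i) * w ^ k" if "i \<le> k" for i
      using that power_add[of w i "k - i"] by (simp add: mult_ac)
    then show "(\<Sum>i\<le>k. a i * w ^ i * (b (k - i) * w ^ (k - i))) = conv a b k * w ^ k"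
      unfolding conv_def sum_distrib_right by (intro sum.cong) auto
  qed
  finally show ?thesis by simp
qed

text \<open>On the circle the product has modulus at most \<open>M\<close> times the squared modulus
  of the polynomial with coefficients \<open>h\<close>. Multiplying by a square is what brings the
  bound into the form required by \<open>coeff_le_mean_square\<close>.\<close>

lemma conv_square_bound:
  fixes b h :: "nat \<Rightarrow> complex"
  assumes sm: "summable (\<lambda>i. cmod (b i))"
    and le: "\<And>w. cmod w = 1 \<Longrightarrow> cmod (\<Sum>i. b i * w ^ i) \<le> M"
    and h: "\<And>j. j > d \<Longrightarrow> h j = 0"
  shows "cmod (conv b (conv h h) n) \<le> M * (\<Sum>j\<le>d. (cmod (h j))\<^sup>2)"
proof (rule coeff_le_mean_square)
  have smh: "summable (\<lambda>i. cmod (h i))"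
    by (rule summable_finite[of "{..d}"]) (use h in auto)
  show "summable (\<lambda>i. cmod (conv b (conv h h) i))"
    by (intro summable_norm_conv sm smh)
  fix w :: complex assume w: "cmod w = 1"
  have "(\<Sum>i. h i * w ^ i) = (\<Sum>j\<le>d. h j * w ^ j)"
    by (rule suminf_finite) (use h in auto)
  then have "(\<Sum>i. conv b (conv h h) i * w ^ i) = (\<Sum>i. b i * w ^ i) * (\<Sum>j\<le>d. h j * w ^ j) ^ 2"
    by (simp add: suminf_conv summable_norm_conv sm smh w power2_eq_square)
  then show "cmod (\<Sum>i. conv b (conv h h) i * w ^ i) \<le> M * (cmod (\<Sum>j\<le>d. h j * w ^ j))\<^sup>2"
    by (simp add: norm_mult norm_power le[OF w] mult_right_mono)
qed

text \<open>What is used of the fact that the power series with coefficients b is bounded by 1 on the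
  unit disk.\<close>

definition schur_bounded :: "(nat \<Rightarrow> complex) \<Rightarrow> bool" where
  "schur_bounded b \<longleftrightarrow>
     (\<forall>h n. (\<forall>j>n. h j = 0) \<longrightarrow> cmod (conv b (conv h h) n) \<le> (\<Sum>j\<le>n. (cmod (h j))\<^sup>2))"

section \<open>Carlson's coefficient bounds\<close>

lemma conv_square_gap:
  assumes h0: "h 0 = 1" and gap: "\<And>j. 0 < j \<Longrightarrow> 2 * j < n \<Longrightarrow> h j = 0" and i: "0 < i" "i \<le> n"
  shows "conv h h i = 2 * h i + (if i = n \<and> even n then (h (n div 2))\<^sup>2 else 0)"
proof -
  have "{..i} = insert 0 (insert i {0<..<i})" using i by auto
  then have "conv h h i = 2 * h i + (\<Sum>l\<in>{0<..<i}. h l * h (i - l))"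
    using i by (simp add: conv_def h0)
  \<comment> \<open>Both \<open>l\<close> and \<open>i - l\<close> are positive with sum at most
    \<open>n\<close>, and by the gap a nonzero product needs each of them to be at least n / 2. So
    only \<open>i = n\<close> with \<open>l = n / 2\<close> survives.\<close>
  also have "(\<Sum>l\<in>{0<..<i}. h l * h (i - l))
      = (\<Sum>l\<in>{0<..<i}. if l = n div 2 then (if i = n \<and> even n then (h (n div 2))\<^sup>2 else 0) else 0)"
  proof (intro sum.cong refl)
    fix l assume l: "l \<in> {0<..<i}"
    show "h l * h (i - l)
        = (if l = n div 2 then (if i = n \<and> even n then (h (n div 2))\<^sup>2 else 0) else 0)"
    proof (cases "2 * l < n \<or> 2 * (i - l) < n")
      case True
      then have "h l * h (i - l) = 0"
        using gap[of l] gap[of "i - l"] l by auto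
      moreover have "\<not> (l = n div 2 \<and> i = n \<and> even n)"
        using True by (auto elim!: evenE)
      ultimately show ?thesis by auto
    next
      case False
      then have "i = n" "n = 2 * l" using l i by auto
      then show ?thesis using l by (simp add: power2_eq_square)
    qed
  qed
  also have "\<dots> = (if i = n \<and> even n then (h (n div 2))\<^sup>2 else 0)"
    using i by (auto elim!: evenE)
  finally show ?thesis .
qed

text \<open>Test \<open>schur_bounded\<close> with a polynomial whose constant coefficient is 1 and
  whose other coefficients are the conjugates of the \<open>b i\<close>, weighted by
  \<open>u i\<close>, in reversed order. As \<open>u\<close> lives on i \<le> n / 2,
  \<open>conv_square_gap\<close> makes its square linear in \<open>u\<close> up to one middle term.
  The linear part gives \<open>2 * u i\<close>, the mean square of the polynomial gives the square
  of \<open>u i\<close>, and the middle term, present for even \<open>n\<close>, comes with the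
  factor \<open>b 0\<close>.\<close>

lemma schur_bounded_weighted:
  assumes sb: "schur_bounded b" and n: "n \<ge> 1" and u: "\<And>i. n < 2 * i \<Longrightarrow> u i = 0"
  shows "cmod (b n) + (\<Sum>i<n. (cmod (b i))\<^sup>2 * (2 * u i - (u i)\<^sup>2))
    \<le> 1 + (if even n then cmod (b 0) * ((cmod (b (n div 2)))\<^sup>2 * (u (n div 2))\<^sup>2) else 0)"
proof -
  obtain e :: complex where e: "cmod e = 1" "b n = cmod (b n) * e"
  proof (cases "b n = 0")
    case True
    then show ?thesis by (intro that[of 1]) auto
  next
    case False
    then show ?thesis by (intro that[of "b n / of_real (cmod (b n))"]) (auto simp: norm_divide)
  qed
  have ee: "cnj e * e = 1"
    using complex_norm_square[of e] e(1) by (simp add: mult.commute)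
  \<comment> \<open>The factor e, the phase of b n, gives all terms b i * h (n - i) the same phase as b n, so
    that they add up in the coefficient of index n of the product of b with h * h.\<close>
  define h where "h j = (if j = 0 then 1 else if j \<le> n then e * cnj (b (n - j)) * u (n - j) else 0)" for j
  define P where "P = (if even n then (h (n div 2))\<^sup>2 else 0)"
  define T where "T = (\<Sum>i<n. (cmod (b i))\<^sup>2 * u i)"
  have h0: "h 0 = 1" by (simp add: h_def)
  have hn: "h (n - i) = e * cnj (b i) * u i" if "i < n" for i
    using that by (simp add: h_def)
  have gap: "h j = 0" if "0 < j" "2 * j < n" for j
    using that u[of "n - j"] by (simp add: h_def)
  have H: "conv h h (n - i) = 2 * h (n - i) + (if i = 0 then P else 0)" if "i < n" for i
    using conv_square_gap[of h n "n - i", OF h0 gap] that by (auto simp: P_def)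
  have "conv b (conv h h) n = b n * conv h h 0 + (\<Sum>i<n. b i * conv h h (n - i))"
    by (simp add: conv_def lessThan_Suc_atMost [symmetric])
  also have "(\<Sum>i<n. b i * conv h h (n - i)) = (\<Sum>i<n. 2 * (b i * h (n - i)) + (if i = 0 then b 0 * P else 0))"
    by (intro sum.cong refl) (auto simp: H algebra_simps)
  also have "\<dots> = 2 * (\<Sum>i<n. b i * h (n - i)) + b 0 * P"
    using n by (simp add: sum.distrib sum_distrib_left)
  also have "(\<Sum>i<n. b i * h (n - i)) = (\<Sum>i<n. e * complex_of_real ((cmod (b i))\<^sup>2 * u i))"
    by (intro sum.cong refl) (simp add: hn complex_norm_square [symmetric] mult_ac del: of_real_power)
  also have "\<dots> = e * T"
    by (simp add: T_def sum_distrib_left)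
  also have "conv h h 0 = 1" by (simp add: conv_def h0)
  finally have c: "conv b (conv h h) n = b n + (2 * (e * T) + b 0 * P)" by simp
  have "(\<Sum>j\<le>n. (cmod (h j))\<^sup>2) = (\<Sum>j\<le>n. (cmod (h (n - j)))\<^sup>2)"
    by (rule sum.reindex_bij_witness[of _ "\<lambda>j. n - j" "\<lambda>j. n - j"]) auto
  also have "\<dots> = 1 + (\<Sum>i<n. (cmod (b i))\<^sup>2 * (u i)\<^sup>2)"
    by (simp add: lessThan_Suc_atMost [symmetric] h0 hn norm_mult e(1) power_mult_distrib)
  finally have hh: "(\<Sum>j\<le>n. (cmod (h j))\<^sup>2) = 1 + (\<Sum>i<n. (cmod (b i))\<^sup>2 * (u i)\<^sup>2)" .
  have "cmod (b n + (2 * (e * T) + b 0 * P)) \<le> 1 + (\<Sum>i<n. (cmod (b i))\<^sup>2 * (u i)\<^sup>2)"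
  proof -
    have "\<forall>j>n. h j = 0" by (simp add: h_def)
    then show ?thesis
      using sb unfolding schur_bounded_def c [symmetric] hh [symmetric] by blast
  qed
  \<comment> \<open>Rotating by \<open>cnj e\<close> makes all terms real except the middle one,
    whose phase is not controlled; the triangle inequality splits it off below.\<close>
  moreover have "cnj e * (b n + (2 * (e * T) + b 0 * P)) = of_real (cmod (b n) + 2 * T) + cnj e * b 0 * P"
  proof -
    have "cnj e * (cmod (b n) * e) = cnj e * e * cmod (b n)"
      "cnj e * (2 * (e * T)) = cnj e * e * of_real (2 * T)"
      by (simp_all add: mult_ac)
    then have "cnj e * b n = cmod (b n)" "cnj e * (2 * (e * T)) = of_real (2 * T)"
      unfolding ee e(2) [symmetric] by simp_all
    then show ?thesis by (simp add: distrib_left mult.assoc)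
  qed
  moreover have "cmod (cnj e * x) = cmod x" for x
    by (simp add: norm_mult e(1))
  ultimately have "cmod (of_real (cmod (b n) + 2 * T) + cnj e * b 0 * P) \<le> 1 + (\<Sum>i<n. (cmod (b i))\<^sup>2 * (u i)\<^sup>2)"
    by metis
  then have "cmod (b n) + 2 * T - cmod (b 0) * cmod P \<le> 1 + (\<Sum>i<n. (cmod (b i))\<^sup>2 * (u i)\<^sup>2)"
    using norm_diff_ineq[of "of_real (cmod (b n) + 2 * T)" "cnj e * b 0 * P"] e(1)
      abs_ge_self[of "cmod (b n) + 2 * T"]
    by (simp only: norm_mult norm_of_real complex_mod_cnj)
  moreover have "cmod P = (if even n then (cmod (b (n div 2)))\<^sup>2 * (u (n div 2))\<^sup>2 else 0)"
  proof -
    have "h (n div 2) = e * cnj (b (n div 2)) * u (n div 2)" if "even n"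
      using hn[of "n div 2"] that n by (auto elim!: evenE)
    then show ?thesis by (simp add: P_def norm_power norm_mult e(1) power_mult_distrib)
  qed
  moreover have "(\<Sum>i<n. (cmod (b i))\<^sup>2 * (2 * u i - (u i)\<^sup>2))
      = 2 * T - (\<Sum>i<n. (cmod (b i))\<^sup>2 * (u i)\<^sup>2)"
    unfolding T_def sum_distrib_left sum_subtractf [symmetric]
    by (intro sum.cong refl) (simp add: algebra_simps)
  ultimately show ?thesis by (simp split: if_splits)
qed

text \<open>The weight 1 maximizes 2 u - u^2, and for an odd index there is no middle term to
  compete with it.\<close>

lemma schur_bounded_carlson_odd:
  assumes "schur_bounded b"
  shows "cmod (b (2 * k + 1)) \<le> 1 - (\<Sum>i\<le>k. (cmod (b i))\<^sup>2)"
proof -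
  have "(\<Sum>i<2 * k + 1. (cmod (b i))\<^sup>2 * (2 * of_bool (i \<le> k) - (of_bool (i \<le> k))\<^sup>2)) = (\<Sum>i\<le>k. (cmod (b i))\<^sup>2)"
    by (rule sum.mono_neutral_cong_right) auto
  then show ?thesis
    using schur_bounded_weighted[OF assms, of "2 * k + 1" "\<lambda>i. of_bool (i \<le> k)"] by simp
qed

text \<open>Below the middle index the weight is 1 as in the odd case. At the index \<open>k\<close>
  the extra term leaves 2 u - (1 + \<alpha>) u^2 to be maximized, where \<alpha> is the modulus of
  \<open>b 0\<close>; the maximum 1 / (1 + \<alpha>) is attained at u = 1 / (1 + \<alpha>). This is
  the origin of the same constant in \<open>bohr_sum\<close>.\<close>

lemma schur_bounded_carlson_even:
  assumes "schur_bounded b" "k \<ge> 1"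
  shows "cmod (b (2 * k)) \<le> 1 - (\<Sum>i<k. (cmod (b i))\<^sup>2) - (cmod (b k))\<^sup>2 / (1 + cmod (b 0))"
proof -
  define \<alpha> where "\<alpha> = cmod (b 0)"
  have pos: "1 + \<alpha> > 0" by (simp add: \<alpha>_def add_pos_nonneg)
  define u where "u i = (if i < k then 1 else if i = k then 1 / (1 + \<alpha>) else 0)" for i
  have "(\<Sum>i<2 * k. (cmod (b i))\<^sup>2 * (2 * u i - (u i)\<^sup>2))
      = (\<Sum>i\<in>insert k {..<k}. (cmod (b i))\<^sup>2 * (2 * u i - (u i)\<^sup>2))"
    by (rule sum.mono_neutral_cong_right) (use assms in \<open>auto simp: u_def\<close>)
  also have "\<dots> = (cmod (b k))\<^sup>2 * (2 * u k - (u k)\<^sup>2) + (\<Sum>i<k. (cmod (b i))\<^sup>2)"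
    by (simp add: u_def)
  finally have main: "cmod (b (2 * k)) + (cmod (b k))\<^sup>2 * (2 * u k - (u k)\<^sup>2) + (\<Sum>i<k. (cmod (b i))\<^sup>2)
      \<le> 1 + \<alpha> * ((cmod (b k))\<^sup>2 * (u k)\<^sup>2)"
    using schur_bounded_weighted[OF assms(1), of "2 * k" u] assms(2) by (simp add: u_def \<alpha>_def)
  have "2 * u k - (u k)\<^sup>2 - \<alpha> * (u k)\<^sup>2 = 1 / (1 + \<alpha>)"
  proof -
    have "(1 + \<alpha>) * u k = 1" using pos by (simp add: u_def)
    then have "u k * ((1 + \<alpha>) * u k) = u k" by simp
    then have "2 * u k - (u k)\<^sup>2 - \<alpha> * (u k)\<^sup>2 = u k"
      by (simp add: algebra_simps power2_eq_square)
    then show ?thesis by (simp add: u_def)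
  qed
  moreover have "(cmod (b k))\<^sup>2 * (2 * u k - (u k)\<^sup>2) - \<alpha> * ((cmod (b k))\<^sup>2 * (u k)\<^sup>2)
      = (cmod (b k))\<^sup>2 * (2 * u k - (u k)\<^sup>2 - \<alpha> * (u k)\<^sup>2)"
    by (simp add: algebra_simps)
  ultimately have "(cmod (b k))\<^sup>2 * (2 * u k - (u k)\<^sup>2) - \<alpha> * ((cmod (b k))\<^sup>2 * (u k)\<^sup>2) = (cmod (b k))\<^sup>2 / (1 + \<alpha>)"
    by simp
  then show ?thesis using main unfolding \<alpha>_def by linarith
qed

lemma schur_bounded_norm_le:
  assumes "schur_bounded b" "n \<ge> 1"
  shows "cmod (b n) \<le> 1 - (cmod (b 0))\<^sup>2"
proof (cases "even n")
  case True
  then obtain k where k: "n = 2 * k" by (auto elim: evenE)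
  have "(cmod (b 0))\<^sup>2 \<le> (\<Sum>i<k. (cmod (b i))\<^sup>2)"
    by (rule member_le_sum) (use assms k in auto)
  moreover have "0 \<le> (cmod (b k))\<^sup>2 / (1 + cmod (b 0))" by simp
  ultimately show ?thesis
    unfolding k using schur_bounded_carlson_even[OF assms(1), of k] assms(2) k by linarith
next
  case False
  then obtain k where k: "n = 2 * k + 1" by (auto elim: oddE)
  have "(cmod (b 0))\<^sup>2 \<le> (\<Sum>i\<le>k. (cmod (b i))\<^sup>2)"
    by (rule member_le_sum) auto
  then show ?thesis
    using schur_bounded_carlson_odd[of b k] assms k by simp
qed

lemma schur_bounded_norm_0_le:
  assumes "schur_bounded b"
  shows "cmod (b 0) \<le> 1"
proof -
  have "(cmod (b 0))\<^sup>2 \<le> 1"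
    using schur_bounded_norm_le[OF assms, of 1] norm_ge_zero[of "b 1"] by linarith
  then show ?thesis by (simp add: abs_square_le_1)
qed

section \<open>From self-maps of the disk to their coefficients\<close>

lemma disk_self_maps_norm_less:
  assumes "f \<in> disk_self_maps" "cmod z < 1"
  shows "cmod (f z) < 1"
proof -
  have "z \<in> ball 0 1" using assms(2) by simp
  then have "f z \<in> ball 0 1" using assms(1) unfolding disk_self_maps_def by blast
  then show ?thesis by simp
qed

text \<open>The power series in w = z^p need not converge on the unit circle, so its coefficients
  are first damped by \<open>r ^ (p * n)\<close> with \<open>r < 1\<close>. On the circle of radius
  \<open>r\<close> removing the factor \<open>z ^ m\<close> costs \<open>1 / r ^ m\<close>, which
  disappears as \<open>r\<close> tends to 1.\<close>

lemma schur_bounded_of_lacunary_expansion: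
  assumes f: "f \<in> disk_self_maps" "lacunary_expansion p m a f" and p: "p \<ge> 1"
  shows "schur_bounded (\<lambda>n. a (p * n + m))"
  unfolding schur_bounded_def
proof (intro allI impI)
  fix h :: "nat \<Rightarrow> complex" and n :: nat
  assume h: "\<forall>j>n. h j = 0"
  let ?b = "\<lambda>n. a (p * n + m)" and ?S = "\<Sum>j\<le>n. (cmod (h j))\<^sup>2"
  let ?c = "\<lambda>r::real. (\<Sum>i\<le>n. ?b i * of_real (r ^ (p * i)) * conv h h (n - i))"
  have expand: "(\<lambda>n. z ^ m * (?b n * (z ^ p) ^ n)) sums f z" if "cmod z < 1" for z
  proof -
    have "z ^ m * (?b n * (z ^ p) ^ n) = ?b n * z ^ (p * n + m)" for n
      by (simp add: power_add power_mult)
    then show ?thesis using f(2) that by (simp only: lacunary_expansion_def) simp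
  qed
  have bound: "r ^ m * cmod (?c r) \<le> ?S" if r: "0 < r" "r < 1" for r :: real
  proof -
    let ?b' = "\<lambda>n. ?b n * of_real (r ^ p) ^ n"
    \<comment> \<open>Convergence at a point of modulus \<open>s > r\<close> gives absolute
      convergence at modulus \<open>r\<close>.\<close>
    define s where "s = (1 + r) / 2"
    have s: "r < s" "0 < s" "s < 1" using r by (auto simp: s_def)
    have "summable (\<lambda>n. of_real s ^ m * (?b n * (of_real s ^ p) ^ n))"
      using expand[of "of_real s"] s by (auto simp: sums_iff)
    then have "summable (\<lambda>n. ?b n * (of_real s ^ p) ^ n)"
      using s(2) by (subst (asm) summable_cmult_iff) auto
    then have sm: "summable (\<lambda>n. cmod (?b' n))"
      by (rule powser_insidea) (use r s p in \<open>auto simp: norm_power intro!: power_strict_mono\<close>)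
    have "cmod (\<Sum>n. ?b' n * w ^ n) \<le> 1 / r ^ m" if w: "cmod w = 1" for w
    proof -
      obtain t where t: "w = cis t"
        using w complex_unimodular_polar by (metis cis.ctr complex_eqI complex.sel)
      \<comment> \<open>A point of modulus \<open>r\<close> whose \<open>p\<close>-th power is
        \<open>r ^ p * w\<close>; thus the bound on \<open>f\<close> covers every \<open>w\<close>
        on the circle.\<close>
      define z where "z = of_real r * cis (t / p)"
      have "cis (t / p) ^ p = w"
        using p Complex.DeMoivre[of "t / p" p] by (simp add: t)
      then have z: "cmod z = r" "z ^ p = of_real (r ^ p) * w"
        using r by (simp_all add: z_def norm_mult power_mult_distrib)
      have "(\<lambda>n. z ^ m * (?b' n * w ^ n)) sums f z"
        using expand[of z] z r by (simp add: power_mult_distrib mult_ac)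
      moreover have "summable (\<lambda>n. ?b' n * w ^ n)"
        by (rule summable_norm_cancel) (use sm w in \<open>simp add: norm_mult norm_power\<close>)
      ultimately have "f z = z ^ m * (\<Sum>n. ?b' n * w ^ n)"
        by (metis sums_unique suminf_mult)
      moreover have "cmod (f z) < 1"
        using disk_self_maps_norm_less[OF f(1)] z r by simp
      ultimately show ?thesis
        using r by (simp add: norm_mult norm_power z field_simps)
    qed
    from conv_square_bound[OF sm this, of n h n] h
    have "cmod (conv ?b' (conv h h) n) \<le> 1 / r ^ m * ?S" by blast
    moreover have "conv ?b' (conv h h) n = ?c r"
      by (simp add: conv_def power_mult)
    ultimately show ?thesis using r by (simp add: field_simps)
  qed
  \<comment> \<open>For fixed \<open>n\<close> only finitely many coefficients enter, so the
    expression is continuous in \<open>r\<close>.\<close>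
  have lim: "((\<lambda>r. r ^ m * cmod (?c r)) \<longlongrightarrow> 1 ^ m * cmod (?c 1)) (at_left 1)"
    by (intro tendsto_intros)
  have "\<forall>\<^sub>F r in at_left 1. r ^ m * cmod (?c r) \<le> ?S"
    using eventually_at_left_real[of 0 "1::real", OF zero_less_one]
    by (rule eventually_mono) (rule bound; simp)
  then have "1 ^ m * cmod (?c 1) \<le> ?S"
    by (rule tendsto_upperbound[OF lim]) simp
  then show "cmod (conv ?b (conv h h) n) \<le> ?S"
    by (simp add: conv_def)
qed

section \<open>Summation of the coefficient bounds\<close>

lemma schur_bounded_bohr_partial_sum:
  fixes \<rho> :: real
  assumes sb: "schur_bounded b" and r: "0 \<le> \<rho>" "\<rho> < 1"
  defines "\<alpha> \<equiv> cmod (b 0)"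
  shows "(\<Sum>n<2 * K + 1. cmod (b (Suc n)) * \<rho> ^ Suc n)
      + (1 / (1 + \<alpha>) + \<rho> / (1 - \<rho>)) * (\<Sum>n<K. (cmod (b (Suc n)))\<^sup>2 * \<rho> ^ (2 * Suc n))
      + \<rho> ^ (2 * K + 2) / (1 - \<rho>) * (1 - \<alpha>\<^sup>2 - (\<Sum>n<K. (cmod (b (Suc n)))\<^sup>2))
    \<le> (1 - \<alpha>\<^sup>2) * \<rho> / (1 - \<rho>)"
\<comment> \<open>The third summand on the left is a reserve for the whole tail: every coefficient
  from index \<open>2 * K + 2\<close> on is bounded by 1 minus the sum of the squares of
  \<open>cmod (b i)\<close> for \<open>i \<le> K\<close>. The induction step pays for two further
  coefficients and one further square out of it.\<close>
proof (induction K)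
  case 0
  have "cmod (b 1) * \<rho> \<le> (1 - \<alpha>\<^sup>2) * \<rho>"
    using schur_bounded_norm_le[OF sb, of 1] r unfolding \<alpha>_def by (intro mult_right_mono) auto
  moreover have "(1 - \<alpha>\<^sup>2) * \<rho> + \<rho>\<^sup>2 / (1 - \<rho>) * (1 - \<alpha>\<^sup>2) = (1 - \<alpha>\<^sup>2) * \<rho> / (1 - \<rho>)"
    using r by (simp add: divide_simps) (simp add: algebra_simps power2_eq_square)
  ultimately show ?case by (simp add: power2_eq_square)
next
  case (Suc K)
  define D where "D = 1 - \<alpha>\<^sup>2 - (\<Sum>n<K. (cmod (b (Suc n)))\<^sup>2)"
  define x where "x = (cmod (b (Suc K)))\<^sup>2"
  define C where "C = 1 / (1 + \<alpha>)"
  define q where "q = \<rho> ^ (2 * K + 2)"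
  define Q where "Q = 1 / (1 - \<rho>)"
  have Q: "Q * \<rho> = Q - 1" using r by (simp add: Q_def field_simps)
  have even: "cmod (b (2 * K + 2)) \<le> D - C * x"
    using schur_bounded_carlson_even[OF sb, of "Suc K"]
    by (simp add: D_def \<alpha>_def C_def x_def sum.lessThan_Suc_shift del: sum.lessThan_Suc)
  have odd: "cmod (b (2 * K + 3)) \<le> D - x"
    using schur_bounded_carlson_odd[OF sb, of "Suc K"]
    by (simp add: D_def \<alpha>_def x_def sum.atMost_shift numeral_3_eq_3)
  have "cmod (b (2 * K + 2)) * q + cmod (b (2 * K + 3)) * (q * \<rho>)
      \<le> (D - C * x) * q + (D - x) * (q * \<rho>)"
    using r by (intro add_mono mult_right_mono even odd) (auto simp: q_def)
  \<comment> \<open>Nothing is lost here: \<open>C * (x * q)\<close> restores what the even bound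
    subtracts at \<open>q\<close>, and \<open>\<rho> * Q * (x * q)\<close> restores the
    \<open>x\<close> missing at all higher powers, since \<open>\<rho> * Q\<close> sums the positive
    powers of \<rho>. This explains the factor in front of the squares.\<close>
  also have "\<dots> + (C + \<rho> * Q) * (x * q) + q * \<rho>\<^sup>2 * Q * (D - x) = q * Q * D"
  proof -
    have "\<rho>\<^sup>2 * Q = \<rho> * (Q * \<rho>)" by (simp add: power2_eq_square mult_ac)
    then have Q2: "1 + \<rho> + \<rho>\<^sup>2 * Q = Q" "\<rho> * Q - \<rho> - \<rho>\<^sup>2 * Q = 0"
      unfolding Q using Q by (simp_all add: algebra_simps)
    have "(D - C * x) * q + (D - x) * (q * \<rho>) + (C + \<rho> * Q) * (x * q) + q * \<rho>\<^sup>2 * Q * (D - x)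
        = q * D * (1 + \<rho> + \<rho>\<^sup>2 * Q) + x * q * (\<rho> * Q - \<rho> - \<rho>\<^sup>2 * Q)"
      by (simp add: algebra_simps)
    then show ?thesis unfolding Q2 by (simp add: mult_ac)
  qed
  finally have step: "cmod (b (2 * K + 2)) * q + cmod (b (2 * K + 3)) * (q * \<rho>)
      + (C + \<rho> * Q) * (x * q) + q * \<rho>\<^sup>2 * Q * (D - x) \<le> q * Q * D" by simp
  have "(\<Sum>n<2 * Suc K + 1. cmod (b (Suc n)) * \<rho> ^ Suc n)
      = (\<Sum>n<2 * K + 1. cmod (b (Suc n)) * \<rho> ^ Suc n) + cmod (b (2 * K + 2)) * q
        + cmod (b (2 * K + 3)) * (q * \<rho>)"
    by (simp add: q_def numeral_3_eq_3 mult_ac)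
  moreover have "\<rho> ^ (2 * Suc K + 2) = q * \<rho>\<^sup>2"
    by (simp add: q_def power2_eq_square mult_ac)
  moreover have "1 - \<alpha>\<^sup>2 - (\<Sum>n<Suc K. (cmod (b (Suc n)))\<^sup>2) = D - x"
    by (simp add: D_def x_def)
  moreover have "(\<Sum>n<Suc K. (cmod (b (Suc n)))\<^sup>2 * \<rho> ^ (2 * Suc n))
      = (\<Sum>n<K. (cmod (b (Suc n)))\<^sup>2 * \<rho> ^ (2 * Suc n)) + x * q"
    by (simp add: x_def q_def)
  ultimately show ?case
    using Suc.IH step
    by (simp only: C_def [symmetric] D_def [symmetric] q_def [symmetric] divide_inverse [of \<rho>]
        divide_inverse [of q] divide_inverse [of "q * \<rho>\<^sup>2"] inverse_eq_divide [of "1 - \<rho>"] Q_def [symmetric])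
      (simp add: distrib_left)
qed

lemma schur_bounded_summable:
  fixes \<rho> :: real
  assumes sb: "schur_bounded b" and r: "0 \<le> \<rho>" "\<rho> < 1"
  shows "summable (\<lambda>n. cmod (b n) * \<rho> ^ n)"
    and "summable (\<lambda>n. (cmod (b (Suc n)))\<^sup>2 * \<rho> ^ (2 * Suc n))"
proof -
  have le1: "cmod (b n) \<le> 1" for n
  proof (cases n)
    case (Suc k)
    then show ?thesis
      using schur_bounded_norm_le[OF sb, of n] zero_le_power2[of "cmod (b 0)"] by linarith
  qed (use schur_bounded_norm_0_le[OF sb] in simp)
  have geo: "summable (\<lambda>n. \<rho> ^ n)" using r by (intro summable_geometric) auto
  show "summable (\<lambda>n. cmod (b n) * \<rho> ^ n)"
    by (rule summable_comparison_test'[OF geo, of 0])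
       (use le1 r in \<open>auto simp: abs_mult intro!: mult_left_le_one_le\<close>)
  show "summable (\<lambda>n. (cmod (b (Suc n)))\<^sup>2 * \<rho> ^ (2 * Suc n))"
  proof (rule summable_comparison_test'[OF geo, of 0])
    fix n
    have "\<rho> ^ (2 * Suc n) \<le> \<rho> ^ n"
      using r by (intro power_decreasing) auto
    then have "(cmod (b (Suc n)))\<^sup>2 * \<rho> ^ (2 * Suc n) \<le> 1 * \<rho> ^ n"
      by (intro mult_mono) (use le1 r in \<open>auto simp: abs_square_le_1\<close>)
    then show "norm ((cmod (b (Suc n)))\<^sup>2 * \<rho> ^ (2 * Suc n)) \<le> \<rho> ^ n"
      using r by simp
  qed
qed

lemma schur_bounded_bohr:
  fixes \<rho> :: real
  assumes sb: "schur_bounded b" and r: "0 \<le> \<rho>" "\<rho> < 1"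
  shows "(\<Sum>n. cmod (b (Suc n)) * \<rho> ^ Suc n)
      + (1 / (1 + cmod (b 0)) + \<rho> / (1 - \<rho>)) * (\<Sum>n. (cmod (b (Suc n)))\<^sup>2 * \<rho> ^ (2 * Suc n))
    \<le> (1 - (cmod (b 0))\<^sup>2) * \<rho> / (1 - \<rho>)"
proof (rule LIMSEQ_le_const2)
  let ?A = "\<lambda>n. cmod (b (Suc n)) * \<rho> ^ Suc n" and ?B = "\<lambda>n. (cmod (b (Suc n)))\<^sup>2 * \<rho> ^ (2 * Suc n)"
  let ?C = "1 / (1 + cmod (b 0)) + \<rho> / (1 - \<rho>)"
  have "summable ?A"
    using schur_bounded_summable(1)[OF assms] by (subst summable_Suc_iff)
  then have "(\<lambda>N. sum ?A {..<N}) \<longlonglongrightarrow> suminf ?A"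
    by (rule summable_LIMSEQ)
  then have A: "(\<lambda>K. sum ?A {..<2 * K + 1}) \<longlonglongrightarrow> suminf ?A"
    by (rule LIMSEQ_subseq_LIMSEQ[unfolded comp_def]) (simp add: strict_mono_def)
  have B: "(\<lambda>K. sum ?B {..<K}) \<longlonglongrightarrow> suminf ?B"
    by (rule summable_LIMSEQ) (rule schur_bounded_summable(2)[OF assms])
  show "(\<lambda>K. sum ?A {..<2 * K + 1} + ?C * sum ?B {..<K}) \<longlonglongrightarrow> suminf ?A + ?C * suminf ?B"
    by (intro tendsto_add tendsto_mult tendsto_const A B)
  have "sum ?A {..<2 * K + 1} + ?C * sum ?B {..<K} \<le> (1 - (cmod (b 0))\<^sup>2) * \<rho> / (1 - \<rho>)" for K
  proof -
    have "0 \<le> cmod (b (2 * K + 1))" by simp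
    also note schur_bounded_carlson_odd[OF sb, of K]
    finally have "0 \<le> 1 - (cmod (b 0))\<^sup>2 - (\<Sum>n<K. (cmod (b (Suc n)))\<^sup>2)"
      by (simp add: sum.atMost_shift)
    then have "0 \<le> \<rho> ^ (2 * K + 2) / (1 - \<rho>) * (1 - (cmod (b 0))\<^sup>2 - (\<Sum>n<K. (cmod (b (Suc n)))\<^sup>2))"
      using r by (intro mult_nonneg_nonneg) auto
    then show ?thesis
      using schur_bounded_bohr_partial_sum[OF assms, of K] by linarith
  qed
  then show "\<exists>N. \<forall>K\<ge>N. sum ?A {..<2 * K + 1} + ?C * sum ?B {..<K} \<le> (1 - (cmod (b 0))\<^sup>2) * \<rho> / (1 - \<rho>)"
    by blast
qed

section \<open>The majorant and the Bohr radius\<close>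

definition bohr_majorant :: "nat \<Rightarrow> nat \<Rightarrow> real \<Rightarrow> real \<Rightarrow> real" where
  "bohr_majorant p m \<alpha> r = r ^ m * (\<alpha> + (1 - \<alpha>\<^sup>2) * r ^ p / (1 - r ^ p))"

text \<open>As only summability is assumed, the formula serves the estimate as well as the exact
  evaluation for the extremal functions.\<close>

lemma bohr_sum_eq:
  fixes r :: real
  assumes sm: "summable (\<lambda>n. cmod (a (p * n + m)) * (r ^ p) ^ n)"
      "summable (\<lambda>n. (cmod (a (p * Suc n + m)))\<^sup>2 * (r ^ p) ^ (2 * Suc n))"
  shows "summable (majorant_term p m a r)" (is ?A)
    and "summable (\<lambda>n. square_term p m a r (Suc n))" (is ?B)
    and "bohr_sum p m a r = r ^ m * (cmod (a m) + ((\<Sum>n. cmod (a (p * Suc n + m)) * (r ^ p) ^ Suc n)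
      + (1 / (1 + cmod (a m)) + r ^ p / (1 - r ^ p))
        * (\<Sum>n. (cmod (a (p * Suc n + m)))\<^sup>2 * (r ^ p) ^ (2 * Suc n))))" (is ?C)
proof -
  have M: "majorant_term p m a r = (\<lambda>n. r ^ m * (cmod (a (p * n + m)) * (r ^ p) ^ n))"
    by (simp add: fun_eq_iff majorant_term_def power_add power_mult)
  have "r ^ (2 * p * Suc n + m) = r ^ m * (r ^ p) ^ (2 * Suc n)" for n
    by (simp only: power_mult [symmetric] power_add [symmetric]) (simp add: algebra_simps)
  then have Q: "(\<lambda>n. square_term p m a r (Suc n))
      = (\<lambda>n. r ^ m * ((cmod (a (p * Suc n + m)))\<^sup>2 * (r ^ p) ^ (2 * Suc n)))"
    by (simp add: fun_eq_iff square_term_def mult.assoc mult.left_commute [of "r ^ m"])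
  show ?A unfolding M by (rule summable_mult[OF sm(1)])
  show ?B unfolding Q by (rule summable_mult[OF sm(2)])
  have "(\<Sum>n. cmod (a (p * n + m)) * (r ^ p) ^ n)
      = cmod (a m) + (\<Sum>n. cmod (a (p * Suc n + m)) * (r ^ p) ^ Suc n)"
    using suminf_split_head[OF sm(1)] by simp
  then show ?C
    unfolding bohr_sum_def M Q suminf_mult[OF sm(1)] suminf_mult[OF sm(2)]
    by (simp only: distrib_left mult.left_commute [of _ "r ^ m"] add.assoc)
qed

text \<open>Multiplying by \<open>1 - r ^ p\<close>, positive for \<open>r < 1\<close>, turns one
  equation into the other. At \<open>r = 1\<close> the fraction degenerates, so that endpoint is
  treated separately.\<close>

lemma is_radius_root_iff_bohr_majorant:
  assumes "p \<ge> 1" "0 < r" "r < 1"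
  shows "is_radius_root p m \<alpha> r \<longleftrightarrow> bohr_majorant p m \<alpha> r = 1"
proof -
  have "1 - r ^ p > 0" using assms by (simp add: power_less_one_iff)
  then show ?thesis
    using assms unfolding is_radius_root_def bohr_majorant_def
    by (simp add: field_simps power_add) (rule eq_commute)
qed

lemma bohr_majorant_strict_mono:
  assumes p: "p \<ge> 1" and a: "0 \<le> \<alpha>" "\<alpha> < 1" and r: "0 \<le> r" "r < s" "s < 1"
  shows "bohr_majorant p m \<alpha> r < bohr_majorant p m \<alpha> s"
proof -
  have pw: "r ^ p < s ^ p" "s ^ p < 1" "0 \<le> r ^ p"
    using p r by (auto intro!: power_strict_mono simp: power_less_one_iff)
  have a2: "0 < 1 - \<alpha>\<^sup>2" using a by (simp add: abs_square_less_1)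
  have "(1 - \<alpha>\<^sup>2) * r ^ p / (1 - r ^ p) < (1 - \<alpha>\<^sup>2) * s ^ p / (1 - s ^ p)"
    using pw a2 by (intro frac_less mult_strict_left_mono mult_nonneg_nonneg) auto
  moreover have "0 \<le> (1 - \<alpha>\<^sup>2) * r ^ p / (1 - r ^ p)"
    using pw a2 by (intro divide_nonneg_nonneg mult_nonneg_nonneg) auto
  \<comment> \<open>Comparison through a mixed product: the power grows weakly, the bracket
    strictly, and \<open>s\<close> is positive.\<close>
  ultimately have "r ^ m * (\<alpha> + (1 - \<alpha>\<^sup>2) * r ^ p / (1 - r ^ p)) \<le> s ^ m * (\<alpha> + (1 - \<alpha>\<^sup>2) * r ^ p / (1 - r ^ p))"
      "s ^ m * (\<alpha> + (1 - \<alpha>\<^sup>2) * r ^ p / (1 - r ^ p)) < s ^ m * (\<alpha> + (1 - \<alpha>\<^sup>2) * s ^ p / (1 - s ^ p))"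
    using a r by (auto intro!: mult_right_mono power_mono)
  then show ?thesis unfolding bohr_majorant_def by (rule le_less_trans)
qed

text \<open>The polynomial, unlike \<open>bohr_majorant\<close>, is continuous up to 1. Its value at
  0 is \<alpha> - 1 for \<open>m = 0\<close> and -1 otherwise; its value at 1 is 1 -
  \<alpha>^2.\<close>

lemma ex_radius_root:
  assumes p: "p \<ge> 1" and a: "0 \<le> \<alpha>" "\<alpha> < 1"
  shows "\<exists>r. 0 < r \<and> r < 1 \<and> is_radius_root p m \<alpha> r"
proof -
  let ?P = "\<lambda>r::real. (1 - \<alpha> - \<alpha>\<^sup>2) * r ^ (p + m) + r ^ p + \<alpha> * r ^ m - 1"
  have P0: "?P 0 < 0" using p a by (cases m) (auto simp: power_0_left)
  have P1: "?P 1 > 0" using a by (simp add: abs_square_less_1)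
  have "\<exists>x\<ge>0. x \<le> 1 \<and> ?P x = 0"
    by (rule IVT') (use P0 P1 in \<open>auto intro!: continuous_intros\<close>)
  then obtain x where x: "0 \<le> x" "x \<le> 1" "?P x = 0" by blast
  moreover have "x \<noteq> 0" "x \<noteq> 1" using x P0 P1 by auto
  ultimately show ?thesis by (auto simp: is_radius_root_def intro!: exI[of _ x])
qed

text \<open>The endpoint 1 is no root, the polynomial being 1 - \<alpha>^2 there. Inside the
  interval the roots are the points where \<open>bohr_majorant\<close> equals 1, and strict
  monotonicity leaves only one.\<close>

lemma ex1_radius_root:
  assumes p: "p \<ge> 1" and a: "0 \<le> \<alpha>" "\<alpha> < 1"
  shows "\<exists>!r. is_radius_root p m \<alpha> r"
proof -
  have lt1: "r < 1" if "is_radius_root p m \<alpha> r" for r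
    using that a by (cases "r = 1") (auto simp: is_radius_root_def abs_square_eq_1 power2_eq_1_iff)
  show ?thesis
  proof (rule ex_ex1I)
    show "\<exists>r. is_radius_root p m \<alpha> r" using ex_radius_root[OF assms] by blast
    fix r s assume rs: "is_radius_root p m \<alpha> r" "is_radius_root p m \<alpha> s"
    then have "bohr_majorant p m \<alpha> r = 1" "bohr_majorant p m \<alpha> s = 1" "0 < r" "0 < s"
      using is_radius_root_iff_bohr_majorant[OF p] lt1 by (auto simp: is_radius_root_def)
    then show "r = s"
      using bohr_majorant_strict_mono[OF p a] lt1 rs by (metis less_eq_real_def linorder_neqE_linordered_idom less_irrefl)
  qed
qed

lemma bohr_radius_less_1:
  assumes "p \<ge> 1" "0 \<le> \<alpha>" "\<alpha> < 1"
  shows "0 < bohr_radius p m \<alpha>" "bohr_radius p m \<alpha> < 1"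
    and "bohr_majorant p m \<alpha> (bohr_radius p m \<alpha>) = 1"
proof -
  obtain r where r: "0 < r" "r < 1" "is_radius_root p m \<alpha> r"
    using ex_radius_root[OF assms] by blast
  then have "bohr_radius p m \<alpha> = r"
    unfolding bohr_radius_def using ex1_radius_root[OF assms] by (intro the1_equality)
  then show "0 < bohr_radius p m \<alpha>" "bohr_radius p m \<alpha> < 1"
      "bohr_majorant p m \<alpha> (bohr_radius p m \<alpha>) = 1"
    using r is_radius_root_iff_bohr_majorant[OF assms(1)] by auto
qed

lemma bohr_majorant_le_1_iff:
  assumes "p \<ge> 1" "0 \<le> \<alpha>" "\<alpha> < 1" "0 \<le> r" "r < 1"
  shows "bohr_majorant p m \<alpha> r \<le> 1 \<longleftrightarrow> r \<le> bohr_radius p m \<alpha>"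
  using bohr_majorant_strict_mono[OF assms(1-3), of r "bohr_radius p m \<alpha>" m]
    bohr_majorant_strict_mono[OF assms(1-3), of "bohr_radius p m \<alpha>" r m]
    bohr_radius_less_1[OF assms(1-3), of m] assms(4,5)
  by (cases r "bohr_radius p m \<alpha>" rule: linorder_cases) auto

text \<open>For \<alpha> = 1 the polynomial factors as the negative of
  \<open>(1 - r ^ p) * (1 - r ^ m)\<close>; with \<open>m = 0\<close> it would vanish
  identically.\<close>

lemma is_radius_root_1_iff:
  assumes "p \<ge> 1" "m \<ge> 1"
  shows "is_radius_root p m 1 r \<longleftrightarrow> r = 1"
proof -
  have "(1 - 1 - 1\<^sup>2) * r ^ (p + m) + r ^ p + 1 * r ^ m - 1 = - ((1 - r ^ p) * (1 - r ^ m))"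
    by (simp add: algebra_simps power_add)
  moreover have "r ^ p < 1" "r ^ m < 1" if "0 < r" "r < 1"
    using that assms by (simp_all add: power_less_one_iff)
  ultimately show ?thesis
    unfolding is_radius_root_def by (auto simp: less_le)
qed

text \<open>If r^p = 1 / (2 + \<alpha>), then r^p / (1 - r^p) = 1 / (1 + \<alpha>), so the bracket
  in \<open>bohr_majorant\<close> is \<alpha> + (1 - \<alpha>) = 1, and the factor
  \<open>r ^ m\<close> cannot increase it.\<close>

lemma bohr_radius_ge_root:
  assumes "p \<ge> 1" "0 \<le> \<alpha>" "\<alpha> < 1"
  shows "root p (1 / (2 + \<alpha>)) \<le> bohr_radius p m \<alpha>"
proof -
  let ?r = "root p (1 / (2 + \<alpha>))"
  have rp: "?r ^ p = 1 / (2 + \<alpha>)" using assms by (intro real_root_pow_pos2) auto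
  have r: "0 \<le> ?r" "?r < 1" using assms by (auto intro!: real_root_ge_zero simp: real_root_lt_1_iff)
  have "\<alpha> + (1 - \<alpha>\<^sup>2) * ?r ^ p / (1 - ?r ^ p) = 1"
    unfolding rp using assms by (simp add: divide_simps power2_eq_square) (simp add: algebra_simps)
  then have "bohr_majorant p m \<alpha> ?r \<le> 1"
    unfolding bohr_majorant_def using r by (simp add: power_le_one)
  then show ?thesis using bohr_majorant_le_1_iff assms r by blast
qed

section \<open>Extremal functions\<close>

definition moebius_coeff :: "nat \<Rightarrow> nat \<Rightarrow> real \<Rightarrow> nat \<Rightarrow> complex" where
  "moebius_coeff p m \<alpha> i = of_real (if i = m then - \<alpha> else (1 - \<alpha>\<^sup>2) * \<alpha> ^ ((i - m) div p - 1))"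

definition moebius_lacunary :: "nat \<Rightarrow> nat \<Rightarrow> real \<Rightarrow> complex \<Rightarrow> complex" where
  "moebius_lacunary p m \<alpha> z = z ^ m * Moebius_function 0 (of_real \<alpha>) (z ^ p)"

text \<open>The quotient \<open>(i - m) div p\<close> recovers the index in the lacunary series,
  along which stand the Taylor coefficients of (w - \<alpha>) / (1 - \<alpha> w).\<close>

lemma moebius_coeff_Suc:
  assumes "p \<ge> 1"
  shows "moebius_coeff p m \<alpha> (p * Suc n + m) = of_real ((1 - \<alpha>\<^sup>2) * \<alpha> ^ n)"
proof -
  have "(p * Suc n + m - m) div p = Suc n" using assms by (simp del: mult_Suc_right)
  then show ?thesis using assms by (simp add: moebius_coeff_def del: mult_Suc_right)
qed

lemma moebius_denominator_nonzero:
  fixes w :: complex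
  assumes "0 \<le> \<alpha>" "\<alpha> < 1" "cmod w < 1"
  shows "cmod (of_real \<alpha> * w) < 1" "1 - of_real \<alpha> * w \<noteq> 0"
proof -
  show "cmod (of_real \<alpha> * w) < 1"
    using assms mult_strict_mono'[of \<alpha> 1 "cmod w" 1] by (simp add: norm_mult)
  then show "1 - of_real \<alpha> * w \<noteq> 0" by auto
qed

lemma moebius_lacunary_disk_self_map:
  assumes p: "p \<ge> 1" and a: "0 \<le> \<alpha>" "\<alpha> < 1"
  shows "moebius_lacunary p m \<alpha> \<in> disk_self_maps"
proof -
  have zp: "cmod (z ^ p) < 1" if "cmod z < 1" for z :: complex
    using that p by (simp add: norm_power power_less_one_iff)
  have "moebius_lacunary p m \<alpha> analytic_on ball 0 1"
    unfolding moebius_lacunary_def Moebius_function_simple complex_cnj_complex_of_real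
    by (intro analytic_intros) (use moebius_denominator_nonzero(2)[OF a] zp in auto)
  moreover have "cmod (moebius_lacunary p m \<alpha> z) < 1" if "cmod z < 1" for z
  proof -
    have "cmod (Moebius_function 0 (of_real \<alpha>) (z ^ p)) < 1"
      by (rule Moebius_function_norm_lt_1) (use a zp that in auto)
    moreover have "cmod (z ^ m) \<le> 1"
      using that by (simp add: norm_power power_le_one)
    ultimately show ?thesis
      unfolding moebius_lacunary_def norm_mult
      by (meson le_less_trans mult_left_le_one_le norm_ge_zero)
  qed
  ultimately show ?thesis by (auto simp: disk_self_maps_def)
qed

text \<open>Write (w - A) / (1 - A w) as -A + (1 - A^2) w / (1 - A w) with w = z^p and expand the
  fraction as a geometric series.\<close>

lemma moebius_lacunary_expansion:
  assumes p: "p \<ge> 1" and a: "0 \<le> \<alpha>" "\<alpha> < 1"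
  shows "lacunary_expansion p m (moebius_coeff p m \<alpha>) (moebius_lacunary p m \<alpha>)"
  unfolding lacunary_expansion_def
proof
  fix z :: complex assume "z \<in> ball 0 1"
  then have z: "cmod (z ^ p) < 1"
    using p by (simp add: norm_power power_less_one_iff)
  note den = moebius_denominator_nonzero[OF a z]
  define A :: complex where "A = of_real \<alpha>"
  define w where "w = z ^ p"
  note den = den[folded A_def w_def]
  have "(\<lambda>n. (1 - A\<^sup>2) * w * (A * w) ^ n) sums ((1 - A\<^sup>2) * w * (1 / (1 - A * w)))"
    by (intro sums_mult geometric_sums den)
  then have "(\<lambda>n. z ^ m * ((1 - A\<^sup>2) * w * (A * w) ^ n)) sums (z ^ m * ((1 - A\<^sup>2) * w * (1 / (1 - A * w))))"
    by (rule sums_mult)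
  moreover have "moebius_coeff p m \<alpha> (p * Suc n + m) * z ^ (p * Suc n + m)
      = z ^ m * ((1 - A\<^sup>2) * w * (A * w) ^ n)" for n
  proof -
    have "z ^ (p * Suc n + m) = w * w ^ n * z ^ m"
      unfolding w_def power_add power_mult by simp
    then show ?thesis
      unfolding moebius_coeff_Suc[OF p] by (simp add: A_def power_mult_distrib)
  qed
  ultimately have "(\<lambda>n. moebius_coeff p m \<alpha> (p * Suc n + m) * z ^ (p * Suc n + m)) sums
      (z ^ m * ((1 - A\<^sup>2) * w * (1 / (1 - A * w))))"
    by presburger
  from sums_Suc[OF this]
  have "(\<lambda>n. moebius_coeff p m \<alpha> (p * n + m) * z ^ (p * n + m)) sums
      (z ^ m * ((1 - A\<^sup>2) * w * (1 / (1 - A * w))) + moebius_coeff p m \<alpha> m * z ^ m)" by simp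
  moreover have "z ^ m * ((1 - A\<^sup>2) * w * (1 / (1 - A * w))) + moebius_coeff p m \<alpha> m * z ^ m
      = moebius_lacunary p m \<alpha> z"
  proof -
    have "(1 - A\<^sup>2) * w * (1 / (1 - A * w)) - A = (w - A) / (1 - A * w)"
      using den(2) by (simp add: divide_simps) (simp add: algebra_simps power2_eq_square)
    moreover have "moebius_lacunary p m \<alpha> z = z ^ m * ((w - A) / (1 - A * w))"
      by (simp add: moebius_lacunary_def Moebius_function_simple A_def w_def)
    moreover have "moebius_coeff p m \<alpha> m = - A"
      by (simp add: moebius_coeff_def A_def)
    ultimately show ?thesis by (metis (no_types, lifting) add_uminus_conv_diff distrib_left mult.commute)
  qed
  ultimately show "(\<lambda>n. moebius_coeff p m \<alpha> (p * n + m) * z ^ (p * n + m)) sums moebius_lacunary p m \<alpha> z"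
    by simp
qed

text \<open>From the second one on, the coefficients form a geometric progression, so both series
  have closed forms, with ratios \<alpha> \<rho> and its square.\<close>

lemma bohr_sum_moebius_coeff:
  assumes p: "p \<ge> 1" and a: "0 \<le> \<alpha>" "\<alpha> < 1" and r: "0 \<le> r" "r < 1"
  shows "bohr_sum p m (moebius_coeff p m \<alpha>) r = bohr_majorant p m \<alpha> r"
proof -
  define \<rho> where "\<rho> = r ^ p"
  have rho: "0 \<le> \<rho>" "\<rho> < 1" using p r by (auto simp: \<rho>_def power_less_one_iff)
  have ar: "0 \<le> \<alpha> * \<rho>" "\<alpha> * \<rho> < 1"
    using a rho mult_strict_mono'[of \<alpha> 1 \<rho> 1] by auto
  have a2: "0 < 1 - \<alpha>\<^sup>2" using a by (simp add: abs_square_less_1)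
  let ?a = "moebius_coeff p m \<alpha>"
  have "(\<lambda>n. (1 - \<alpha>\<^sup>2) * \<rho> * (\<alpha> * \<rho>) ^ n) sums ((1 - \<alpha>\<^sup>2) * \<rho> * (1 / (1 - \<alpha> * \<rho>)))"
    by (intro sums_mult geometric_sums) (use ar in auto)
  moreover have "cmod (?a (p * Suc n + m)) * \<rho> ^ Suc n = (1 - \<alpha>\<^sup>2) * \<rho> * (\<alpha> * \<rho>) ^ n" for n
    unfolding moebius_coeff_Suc[OF p] norm_of_real using a a2 by (simp add: abs_mult power_mult_distrib mult_ac)
  ultimately have 1: "(\<lambda>n. cmod (?a (p * Suc n + m)) * \<rho> ^ Suc n) sums ((1 - \<alpha>\<^sup>2) * \<rho> * (1 / (1 - \<alpha> * \<rho>)))"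
    by presburger
  have ar2: "(\<alpha> * \<rho>)\<^sup>2 < 1" using ar by (simp add: abs_square_less_1)
  have "(\<lambda>n. ((1 - \<alpha>\<^sup>2) * \<rho>)\<^sup>2 * ((\<alpha> * \<rho>)\<^sup>2) ^ n) sums (((1 - \<alpha>\<^sup>2) * \<rho>)\<^sup>2 * (1 / (1 - (\<alpha> * \<rho>)\<^sup>2)))"
    by (intro sums_mult geometric_sums) (use ar2 in auto)
  moreover have "(cmod (?a (p * Suc n + m)))\<^sup>2 * \<rho> ^ (2 * Suc n) = ((1 - \<alpha>\<^sup>2) * \<rho>)\<^sup>2 * ((\<alpha> * \<rho>)\<^sup>2) ^ n" for n
  proof -
    have "\<rho> ^ (2 * Suc n) = \<rho>\<^sup>2 * (\<rho>\<^sup>2) ^ n" "(\<alpha> ^ n)\<^sup>2 = (\<alpha>\<^sup>2) ^ n"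
      unfolding power_mult power_Suc by (simp_all add: mult.commute flip: power_mult)
    then show ?thesis
      unfolding moebius_coeff_Suc[OF p] norm_of_real power2_abs by (simp only: power_mult_distrib mult_ac)
  qed
  ultimately have 2: "(\<lambda>n. (cmod (?a (p * Suc n + m)))\<^sup>2 * \<rho> ^ (2 * Suc n)) sums (((1 - \<alpha>\<^sup>2) * \<rho>)\<^sup>2 * (1 / (1 - (\<alpha> * \<rho>)\<^sup>2)))"
    by presburger
  have am: "cmod (?a m) = \<alpha>" using a by (simp add: moebius_coeff_def)
  have "summable (\<lambda>n. cmod (?a (p * n + m)) * \<rho> ^ n)"
    using sums_summable[OF 1] summable_Suc_iff[of "\<lambda>n. cmod (?a (p * n + m)) * \<rho> ^ n"] by blast
  then have "bohr_sum p m ?a r = r ^ m * (\<alpha> + ((1 - \<alpha>\<^sup>2) * \<rho> * (1 / (1 - \<alpha> * \<rho>))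
      + (1 / (1 + \<alpha>) + \<rho> / (1 - \<rho>)) * (((1 - \<alpha>\<^sup>2) * \<rho>)\<^sup>2 * (1 / (1 - (\<alpha> * \<rho>)\<^sup>2)))))"
    using bohr_sum_eq(3)[of ?a p m r, folded \<rho>_def] sums_summable[OF 2]
    unfolding am sums_unique[OF 1, symmetric] sums_unique[OF 2, symmetric] by blast
  \<comment> \<open>The factor in front of the squares is (1 + \<alpha> \<rho>) / ((1 + \<alpha>) (1
    - \<rho>)). Its numerator cancels against a factor of 1 - (\<alpha> \<rho>)^2, and the two
    remaining fractions add up to the right-hand side.\<close>
  also have "(1 - \<alpha>\<^sup>2) * \<rho> * (1 / (1 - \<alpha> * \<rho>))
      + (1 / (1 + \<alpha>) + \<rho> / (1 - \<rho>)) * (((1 - \<alpha>\<^sup>2) * \<rho>)\<^sup>2 * (1 / (1 - (\<alpha> * \<rho>)\<^sup>2)))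
      = (1 - \<alpha>\<^sup>2) * \<rho> / (1 - \<rho>)"
  proof -
    define u v t where "u = 1 - \<alpha> * \<rho>" and "v = 1 - \<rho>" and "t = 1 + \<alpha>"
    have nz: "u \<noteq> 0" "v \<noteq> 0" "t \<noteq> 0" "1 + \<alpha> * \<rho> \<noteq> 0"
      using ar rho a unfolding u_def v_def t_def by linarith+
    have "1 / t + \<rho> / v = (1 + \<alpha> * \<rho>) / (t * v)"
      using nz(2,3) by (simp add: divide_simps) (simp add: t_def v_def algebra_simps)
    moreover have "1 - (\<alpha> * \<rho>)\<^sup>2 = (1 + \<alpha> * \<rho>) * u"
      by (simp add: u_def algebra_simps power2_eq_square)
    moreover have "((1 - \<alpha>\<^sup>2) * \<rho>)\<^sup>2 = (1 - \<alpha>\<^sup>2) * \<rho> * (t * (1 - \<alpha>) * \<rho>)"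
      by (simp add: t_def algebra_simps power2_eq_square)
    ultimately have "(1 / t + \<rho> / v) * (((1 - \<alpha>\<^sup>2) * \<rho>)\<^sup>2 * (1 / (1 - (\<alpha> * \<rho>)\<^sup>2)))
        = (1 - \<alpha>\<^sup>2) * \<rho> * ((1 - \<alpha>) * \<rho> / (u * v))"
      using nz by (simp add: mult_ac)
    moreover have "1 / u + (1 - \<alpha>) * \<rho> / (u * v) = 1 / v"
      using nz(1,2) by (simp add: divide_simps) (simp add: u_def v_def algebra_simps)
    ultimately show ?thesis
      unfolding u_def [symmetric] v_def [symmetric] t_def [symmetric]
      by (metis distrib_left mult.right_neutral times_divide_eq_right)
  qed
  finally show ?thesis by (simp add: bohr_majorant_def \<rho>_def)
qed

section \<open>The inequality and its sharpness\<close>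

theorem theorem3:
  fixes p m :: nat
  assumes "p \<ge> 1" and "m \<le> p"
  shows
    "(\<forall>f a. f \<in> disk_self_maps \<and> lacunary_expansion p m a f \<longrightarrow>
        (\<exists>!r. is_radius_root p m (cmod (a m)) r) \<and>
        (\<forall>r. 0 \<le> r \<and> r < 1 \<longrightarrow>
           summable (majorant_term p m a r) \<and>
           summable (\<lambda>n. square_term p m a r (Suc n)) \<and>
           (r \<le> bohr_radius p m (cmod (a m)) \<longrightarrow> bohr_sum p m a r \<le> 1)) \<and>
        bohr_radius p m (cmod (a m)) \<ge> root p (1 / (2 + cmod (a m))))
     \<and>
     (\<forall>\<alpha> R. 0 \<le> \<alpha> \<and> \<alpha> < 1 \<and> bohr_radius p m \<alpha> < R \<longrightarrow>
        (\<exists>f a r. f \<in> disk_self_maps \<and> lacunary_expansion p m a f \<and> cmod (a m) = \<alpha> \<and>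
           0 \<le> r \<and> r < 1 \<and> r \<le> R \<and> bohr_sum p m a r > 1))"
proof (intro conjI allI impI)
  fix f a assume "f \<in> disk_self_maps \<and> lacunary_expansion p m a f"
  then have f: "f \<in> disk_self_maps" "lacunary_expansion p m a f" by auto
  note sb = schur_bounded_of_lacunary_expansion[OF f assms(1)]
  let ?\<alpha> = "cmod (a m)"
  have a_le: "?\<alpha> \<le> 1" using schur_bounded_norm_0_le[OF sb] by simp
  \<comment> \<open>For \<open>m = 0\<close> the first coefficient is \<open>f 0\<close>, which lies
    inside the disk. So modulus 1 occurs only for \<open>m \<ge> 1\<close>, where the radius
    equation is still nontrivial.\<close>
  have a_less: "?\<alpha> < 1" if "m = 0"
  proof -
    have "(\<lambda>n. a (p * n + m) * 0 ^ (p * n + m)) sums f 0"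
      using f(2) by (auto simp: lacunary_expansion_def)
    moreover have "a (p * n + m) * 0 ^ (p * n + m) = (if n = 0 then a m else 0)" for n
      using that assms(1) by auto
    ultimately have "(\<lambda>n. if n = 0 then a m else 0) sums f 0" by (simp only:)
    then have "f 0 = a m" using sums_single[of 0 "\<lambda>_. a m"] by (metis sums_unique2)
    moreover have "cmod (f 0) < 1" using disk_self_maps_norm_less[OF f(1)] by simp
    ultimately show ?thesis by simp
  qed
  \<comment> \<open>In the degenerate case of modulus 1 the root is the endpoint 1, so the radius
    condition admits every \<open>r < 1\<close>.\<close>
  have root1: "is_radius_root p m ?\<alpha> r \<longleftrightarrow> r = 1" if "\<not> ?\<alpha> < 1" for r
    using that a_le a_less is_radius_root_1_iff[OF assms(1), of m r] by fastforce
  have radius1: "bohr_radius p m ?\<alpha> = 1" if "\<not> ?\<alpha> < 1"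
    unfolding bohr_radius_def root1[OF that] by simp
  show "\<exists>!r. is_radius_root p m ?\<alpha> r"
    using ex1_radius_root[OF assms(1), of ?\<alpha>] root1 by (cases "?\<alpha> < 1") auto
  show "bohr_radius p m ?\<alpha> \<ge> root p (1 / (2 + ?\<alpha>))"
  proof (cases "?\<alpha> < 1")
    case False
    have "root p (1 / (2 + ?\<alpha>)) \<le> 1"
      using assms(1) add_pos_nonneg[of 2 ?\<alpha>] by (simp add: real_root_le_1_iff divide_le_eq)
    then show ?thesis using radius1[OF False] by simp
  qed (use bohr_radius_ge_root[OF assms(1)] in simp)
  fix r :: real assume "0 \<le> r \<and> r < 1"
  then have r: "0 \<le> r" "r < 1" by auto
  then have rho: "0 \<le> r ^ p" "r ^ p < 1"
    using assms(1) by (auto simp: power_less_one_iff)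
  note sum = bohr_sum_eq[OF schur_bounded_summable[OF sb rho]]
  show "summable (majorant_term p m a r)" "summable (\<lambda>n. square_term p m a r (Suc n))"
    using sum(1,2) by auto
  assume le: "r \<le> bohr_radius p m ?\<alpha>"
  have "bohr_sum p m a r \<le> bohr_majorant p m ?\<alpha> r"
    unfolding sum(3) bohr_majorant_def
    using schur_bounded_bohr[OF sb rho] r by (intro mult_left_mono add_left_mono) auto
  also have "\<dots> \<le> 1"
  proof (cases "?\<alpha> < 1")
    case True
    then show ?thesis using bohr_majorant_le_1_iff[OF assms(1) _ _ r] le by simp
  next
    case False
    \<comment> \<open>The first coefficient has modulus 1 here, and the majorant reduces to
      \<open>r ^ m\<close>.\<close>
    then show ?thesis using a_le r by (simp add: bohr_majorant_def power_le_one)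
  qed
  finally show "bohr_sum p m a r \<le> 1" .
next
  fix \<alpha> R :: real assume "0 \<le> \<alpha> \<and> \<alpha> < 1 \<and> bohr_radius p m \<alpha> < R"
  then have a: "0 \<le> \<alpha>" "\<alpha> < 1" and R: "bohr_radius p m \<alpha> < R" by auto
  note rad = bohr_radius_less_1[OF assms(1) a, of m]
  \<comment> \<open>A point beyond the radius but below 1, however large \<open>R\<close> is; there
    the Bohr sum of the extremal function equals the majorant, which exceeds 1.\<close>
  obtain r where r: "bohr_radius p m \<alpha> < r" "r < min R 1"
    using dense[of "bohr_radius p m \<alpha>" "min R 1"] R rad(2) by auto
  then have r01: "0 \<le> r" "r < 1" using rad(1) by auto
  have "bohr_sum p m (moebius_coeff p m \<alpha>) r > 1"
    using bohr_sum_moebius_coeff[OF assms(1) a r01] bohr_majorant_le_1_iff[OF assms(1) a r01, of m] r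
    by (simp add: not_le [symmetric])
  moreover have "cmod (moebius_coeff p m \<alpha> m) = \<alpha>" using a by (simp add: moebius_coeff_def)
  ultimately show "\<exists>f a r. f \<in> disk_self_maps \<and> lacunary_expansion p m a f \<and> cmod (a m) = \<alpha> \<and>
      0 \<le> r \<and> r < 1 \<and> r \<le> R \<and> bohr_sum p m a r > 1"
    using moebius_lacunary_disk_self_map[OF assms(1) a] moebius_lacunary_expansion[OF assms(1) a] r r01
    by (intro exI[of _ "moebius_lacunary p m \<alpha>"] exI[of _ "moebius_coeff p m \<alpha>"] exI[of _ r]) auto
qed

end
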